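(* Assume that the events $E_1,E_2,E_3,H_1,H_2,H_3$ are logically independent, with $H_1\neq\emptyset$, $H_2\neq\emptyset$, $H_3\neq\emptyset$. If the assessment $\mathcal M=(x_1,x_2,x_3,x_{12},x_{13},x_{23},x_{123})$ on $\mathcal F=\{\mathcal C_1,\mathcal C_2,\mathcal C_3,\mathcal C_{12},\mathcal C_{13},\mathcal C_{23},\mathcal C_{123}\}$ is such that $(x_1,x_2,x_3)\in[0,1]^3$, $x_{ij}=\min\{x_i,x_j\}$ for $i\neq j$, and $x_{123}=\min\{x_1,x_2,x_3\}$, then $\mathcal M$ is coherent. Moreover, $\mathcal C_{ij}=\min\{\mathcal C_i,\mathcal C_j\}$ for $i\neq j$, and $\mathcal C_{123}=\min\{\mathcal C_1,\mathcal C_2,\mathcal C_3\}$ (as random quantities).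
   Context: **Events.** Events are subsets of a set $\Omega$ of elementary outcomes; $\overline{E}$ is the complement of $E$, juxtaposition $EF$ denotes intersection, $\vee$ denotes union. Events $F_1,\dots,F_n$ are logically independent if all $2^n$ intersections $F_1^*\cdots F_n^*$, with $F_i^*\in\{F_i,\overline{F}_i\}$, are nonempty. **Conjunctions.** Given conditional events $E_1|H_1,E_2|H_2,E_3|H_3$ and a real number $x_S$ for each nonempty $S\subseteq\{1,2,3\}$ (written $x_i,x_{ij},x_{123}$, with $x_{ij}=x_{ji}$), where $x_S$ is the prevision assessed on $\bigwedge_{i\in S}(E_i|H_i)$, the conjunction $\mathcal C_S=\bigwedge_{i\in S}(E_i|H_i)$ (written $\mathcal C_i,\mathcal C_{ij},\mathcal C_{123}$) is the random quantity equal to: $1$ on $\bigwedge_{i\in S}E_iH_i$; $0$ on $\bigvee_{i\in S}\overline{E}_iH_i$; and $x_{S'}$ on $\bigwedge_{i\in S'}\overline{H}_i\wedge\bigwedge_{i\in S\setminus S'}E_iH_i$, for each $\emptyset\neq S'\subseteq S$. In particular $\mathcal C_i=E_i|H_i$ equals $1$ on $E_iH_i$, $0$ on $\overline{E}_iH_i$, $x_i$ on $\overline{H}_i$. $\mathcal C_S$ is a conditional random quantity with conditioning event $\bigvee_{i\in S}H_i$ and prevision $x_S$. **Coherence.** Let $\mathcal F=\{X_1|K_1,\dots,X_n|K_n\}$ be a finite family of conditional random quantities, where $X_i$ takes finitely many real values when the conditioning event $K_i\ne\emptyset$ is true, and let $\mathcal M=(\mu_1,\dots,\mu_n)\in\mathbb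 R^n$ be a (prevision) assessment, $\mu_i=\mathbb P(X_i|K_i)$. Let $C_1,\dots,C_m$ be the constituents contained in $K_1\vee\cdots\vee K_n$, i.e. the nonempty atoms of the finite partition generated by the events $K_i$ and the events $(X_i=\text{value})\cap K_i$. To $C_h$ associate $Q_h=(q_{h1},\dots,q_{hn})$, where $q_{hi}$ is the value of $X_i$ on $C_h$ if $C_h\subseteq K_i$, and $q_{hi}=\mu_i$ if $C_h\subseteq\overline{K}_i$. Let $S$ be the set of vectors $(\lambda_1,\dots,\lambda_m)$ with $\lambda_h\ge 0$, $\sum_h\lambda_h=1$, $\sum_h\lambda_hQ_h=\mathcal M$, and, when $S\neq\emptyset$, let $I_0=\{i:\max_{\Lambda\in S}\sum_{h:C_h\subseteq K_i}\lambda_h=0\}$. Then $\mathcal M$ is coherent on $\mathcal F$ if and only if (i) $S\neq\emptyset$, and (ii) if $I_0\ne\emptyset$, then the sub-assessment $(\mu_i,\ i\in I_0)$ on $\{X_i|K_i,\ i\in I_0\}$ is coherent (the recursion terminates because $I_0$ is a proper subset of $\{1,\dots,n\}$). *)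

theory Defs
  imports Complex_Main
begin

text \<open>The set of elementary outcomes is the universe of the type \<open>'w\<close>; events are
  sets of type \<open>'w set\<close> and random quantities are functions \<open>'w \<Rightarrow> real\<close>.
  In a family indexed by \<open>I\<close>, the index \<open>i\<close> stands for the conditional
  random quantity \<open>X i | K i\<close>.\<close>

definition logically_independent :: "'i set \<Rightarrow> ('i \<Rightarrow> 'w set) \<Rightarrow> bool" where
  "logically_independent I F \<longleftrightarrow>
     (\<forall>J \<subseteq> I. (\<Inter>i\<in>J. F i) \<inter> (\<Inter>i\<in>I - J. - F i) \<noteq> {})"

text \<open>The conjunction of the conditional events \<open>E i | H i\<close>, \<open>i \<in> S\<close>, where \<open>x S'\<close> is the
  prevision assessed on the conjunction indexed by \<open>S'\<close>. In the last branch
  \<open>S' = {i \<in> S. w \<notin> H i}\<close> is nonempty and \<open>w \<in> E i \<inter> H i\<close> for the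
  remaining \<open>i \<in> S - S'\<close>.\<close>

definition conjunction ::
    "('i \<Rightarrow> 'w set) \<Rightarrow> ('i \<Rightarrow> 'w set) \<Rightarrow> ('i set \<Rightarrow> real) \<Rightarrow> 'i set \<Rightarrow> 'w \<Rightarrow> real" where
  "conjunction E H x S w =
     (if \<forall>i\<in>S. w \<in> E i \<inter> H i then 1
      else if \<exists>i\<in>S. w \<in> - E i \<inter> H i then 0
      else x {i \<in> S. w \<notin> H i})"

definition conditioning :: "('i \<Rightarrow> 'w set) \<Rightarrow> 'i set \<Rightarrow> 'w set" where
  "conditioning H S = (\<Union>i\<in>S. H i)"

definition cond_rq_family :: "('i \<Rightarrow> 'w \<Rightarrow> real) \<Rightarrow> ('i \<Rightarrow> 'w set) \<Rightarrow> 'i set \<Rightarrow> bool" where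
  "cond_rq_family X K I \<longleftrightarrow> finite I \<and> (\<forall>i\<in>I. K i \<noteq> {} \<and> finite (X i ` K i))"

text \<open>Two outcomes lie in the same atom iff no \<open>K i\<close> and no \<open>(X i = v) \<inter> K i\<close> separates them.\<close>

definition same_atom :: "('i \<Rightarrow> 'w \<Rightarrow> real) \<Rightarrow> ('i \<Rightarrow> 'w set) \<Rightarrow> 'i set \<Rightarrow> ('w \<times> 'w) set" where
  "same_atom X K I =
     {(w, w'). \<forall>i\<in>I. (w \<in> K i \<longleftrightarrow> w' \<in> K i) \<and> (w \<in> K i \<longrightarrow> X i w = X i w')}"

definition constituents :: "('i \<Rightarrow> 'w \<Rightarrow> real) \<Rightarrow> ('i \<Rightarrow> 'w set) \<Rightarrow> 'i set \<Rightarrow> 'w set set" where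
  "constituents X K I = (\<Union>i\<in>I. K i) // same_atom X K I"

definition point ::
    "('i \<Rightarrow> 'w \<Rightarrow> real) \<Rightarrow> ('i \<Rightarrow> 'w set) \<Rightarrow> ('i \<Rightarrow> real) \<Rightarrow> 'w set \<Rightarrow> 'i \<Rightarrow> real" where
  "point X K \<mu> C i = (if C \<subseteq> K i then the_elem (X i ` C) else \<mu> i)"

text \<open>A vector \<open>\<Lambda>\<close> is a function on constituents; its values elsewhere are irrelevant.\<close>

definition solutions ::
    "('i \<Rightarrow> 'w \<Rightarrow> real) \<Rightarrow> ('i \<Rightarrow> 'w set) \<Rightarrow> ('i \<Rightarrow> real) \<Rightarrow> 'i set \<Rightarrow> ('w set \<Rightarrow> real) set" where
  "solutions X K \<mu> I =
     {\<Lambda>. (\<forall>C\<in>constituents X K I. 0 \<le> \<Lambda> C) \<and>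
          (\<Sum>C\<in>constituents X K I. \<Lambda> C) = 1 \<and>
          (\<forall>i\<in>I. (\<Sum>C\<in>constituents X K I. \<Lambda> C * point X K \<mu> C i) = \<mu> i)}"

text \<open>The supremum below is a maximum: up to irrelevant values, the solutions form a compact set.
  It is used only when there are solutions.\<close>

definition zero_indices ::
    "('i \<Rightarrow> 'w \<Rightarrow> real) \<Rightarrow> ('i \<Rightarrow> 'w set) \<Rightarrow> ('i \<Rightarrow> real) \<Rightarrow> 'i set \<Rightarrow> 'i set" where
  "zero_indices X K \<mu> I =
     {i \<in> I. (SUP \<Lambda>\<in>solutions X K \<mu> I. \<Sum>C | C \<in> constituents X K I \<and> C \<subseteq> K i. \<Lambda> C) = 0}"

lemma zero_indices_psubset:
  assumes "solutions X K \<mu> I \<noteq> {}"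
  shows "zero_indices X K \<mu> I \<subset> I"
proof -
  let ?N = "constituents X K I"
  let ?g = "\<lambda>i \<Lambda>. \<Sum>C | C \<in> ?N \<and> C \<subseteq> K i. \<Lambda> C"
  obtain \<Lambda> where \<Lambda>: "\<Lambda> \<in> solutions X K \<mu> I"
    using assms by blast
  then have sum1: "sum \<Lambda> ?N = 1" and nonneg: "\<And>C. C \<in> ?N \<Longrightarrow> 0 \<le> \<Lambda> C"
    by (auto simp: solutions_def)
  then have fin: "finite ?N"
    by (metis sum.infinite zero_neq_one)
  obtain C where C: "C \<in> ?N" "\<Lambda> C \<noteq> 0"
    using sum1 by (metis sum.neutral zero_neq_one)
  obtain w i where i: "i \<in> I" "w \<in> K i" "C = same_atom X K I `` {w}"
    using C(1) by (auto simp: constituents_def quotient_def)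
  then have sub: "C \<subseteq> K i"
    by (auto simp: same_atom_def)
  have "0 < \<Lambda> C"
    using C nonneg[of C] by simp
  also have "\<Lambda> C \<le> ?g i \<Lambda>"
    using C(1) sub fin nonneg by (intro member_le_sum) auto
  also have "?g i \<Lambda> \<le> (SUP \<Lambda>\<in>solutions X K \<mu> I. ?g i \<Lambda>)"
  proof (rule cSUP_upper[OF \<Lambda>], rule bdd_aboveI2)
    fix \<Lambda>' assume "\<Lambda>' \<in> solutions X K \<mu> I"
    then have "sum \<Lambda>' ?N = 1" "\<And>C. C \<in> ?N \<Longrightarrow> 0 \<le> \<Lambda>' C"
      by (auto simp: solutions_def)
    moreover from this have "?g i \<Lambda>' \<le> sum \<Lambda>' ?N"
      using fin by (intro sum_mono2) auto
    ultimately show "?g i \<Lambda>' \<le> 1"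
      by simp
  qed
  finally have "i \<notin> zero_indices X K \<mu> I"
    by (simp add: zero_indices_def)
  then show ?thesis
    using i(1) by (auto simp: zero_indices_def)
qed

context
  notes conj_cong [fundef_cong]
begin

function coherent ::
    "('i \<Rightarrow> 'w \<Rightarrow> real) \<Rightarrow> ('i \<Rightarrow> 'w set) \<Rightarrow> ('i \<Rightarrow> real) \<Rightarrow> 'i set \<Rightarrow> bool" where
  "coherent X K \<mu> I \<longleftrightarrow>
     cond_rq_family X K I \<and> solutions X K \<mu> I \<noteq> {} \<and>
     (zero_indices X K \<mu> I \<noteq> {} \<longrightarrow> coherent X K \<mu> (zero_indices X K \<mu> I))"
  by pat_completeness auto
termination
  by (relation "measure (\<lambda>(X, K, \<mu>, I). card I)")
     (auto simp: cond_rq_family_def intro!: psubset_card_mono zero_indices_psubset)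

end

declare coherent.simps [simp del]

end

theory Submission
  imports Defs "HOL-Library.FuncSet"
begin

text \<open>If \<open>U\<close> is uniform on \<open>[0, 1]\<close>, then \<open>U \<le> x\<^sub>i\<close> for all \<open>i \<in> S\<close> with
  probability \<open>min {x\<^sub>i | i \<in> S}\<close>. By logical independence, this coupling is realised by outcomes
  at which every \<open>H i\<close> is true and \<open>E i\<close> is true iff \<open>U \<le> x\<^sub>i\<close>. It solves the linear
  system and gives mass one to every conditioning event, so that \<open>I\<^sub>0\<close> is empty and the recursion
  in the definition of coherence stops at once.\<close>

section \<open>Constituents and a sufficient condition for coherence\<close>

text \<open>An atom is a fibre of the map \<open>V\<close> that records, for each index, what an
  outcome reveals about \<open>X i | K i\<close>: the value of \<open>X i\<close>, or
  \<open>None\<close> where \<open>K i\<close> fails. \<open>V\<close> takes its values in a finite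
  product. Finiteness matters because sums over infinite sets are 0 by convention.\<close>

lemma finite_constituents:
  assumes "cond_rq_family X K I"
  shows "finite (constituents X K I)"
proof -
  define V where "V w = (\<lambda>i\<in>I. if w \<in> K i then Some (X i w) else None)" for w
  let ?P = "\<Pi>\<^sub>E i\<in>I. insert None (Some ` X i ` K i)"
  have V_eqI: "V w = V w'" if "\<And>i. i \<in> I \<Longrightarrow> V w i = V w' i" for w w'
    using that unfolding V_def by (rule extensionalityI[OF restrict_extensional restrict_extensional])
  have V_eq_iff: "V w i = V w' i \<longleftrightarrow> (w \<in> K i \<longleftrightarrow> w' \<in> K i) \<and> (w \<in> K i \<longrightarrow> X i w = X i w')"
    if "i \<in> I" for w w' i
    using that by (simp add: V_def)
  have "(w, w') \<in> same_atom X K I \<longleftrightarrow> (\<forall>i\<in>I. V w i = V w' i)" for w w'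
    by (simp add: same_atom_def V_eq_iff)
  then have "(w, w') \<in> same_atom X K I \<longleftrightarrow> V w = V w'" for w w'
    by (metis V_eqI)
  then have atom: "same_atom X K I `` {w} = {w'. V w = V w'}" for w
    by blast
  have V_P: "V w \<in> ?P" for w
    by (auto simp: V_def)
  have "constituents X K I \<subseteq> (\<lambda>v. {w'. v = V w'}) ` ?P"
  proof
    fix C
    assume "C \<in> constituents X K I"
    then obtain w where "C = same_atom X K I `` {w}"
      unfolding constituents_def by (rule quotientE)
    then show "C \<in> (\<lambda>v. {w'. v = V w'}) ` ?P"
      unfolding atom using V_P by (rule image_eqI)
  qed
  moreover have "finite ?P"
    using assms by (intro finite_PiE) (auto simp: cond_rq_family_def)
  ultimately show ?thesis
    by (rule finite_surj[rotated])
qed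

text \<open>Weights on sample outcomes \<open>w k\<close> are pushed forward to the atoms containing
  them. Since every \<open>K i\<close> holds at every \<open>w k\<close>, no coordinate of a charged
  point falls back on \<open>\<mu>\<close>, and each conditioning event receives mass 1, which
  leaves no zero indices.\<close>

lemma coherent_if_mixture:
  assumes fam: "cond_rq_family X K I" and "I \<noteq> {}"
    and fin: "finite T"
    and p_nonneg: "\<And>k. k \<in> T \<Longrightarrow> 0 \<le> p k" and p_sum: "sum p T = 1"
    and w: "\<And>i k. i \<in> I \<Longrightarrow> k \<in> T \<Longrightarrow> w k \<in> K i"
    and prev: "\<And>i. i \<in> I \<Longrightarrow> (\<Sum>k\<in>T. p k * X i (w k)) = \<mu> i"
  shows "coherent X K \<mu> I"
proof -
  let ?N = "constituents X K I"
  define atom where "atom k = same_atom X K I `` {w k}" for k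
  \<comment> \<open>Distinct \<open>k\<close> may fall into the same atom; their weights add
    up.\<close>
  define \<Lambda> where "\<Lambda> C = (\<Sum>k\<in>T. if C = atom k then p k else 0)" for C
  note finN = finite_constituents[OF fam]
  have atom_N: "atom k \<in> ?N" if "k \<in> T" for k
  proof -
    have "w k \<in> (\<Union>i\<in>I. K i)"
      using that w \<open>I \<noteq> {}\<close> by blast
    then show ?thesis
      unfolding atom_def constituents_def by (rule quotientI)
  qed
  have in_atom: "w' \<in> K i" "X i w' = X i (w k)" if "w' \<in> atom k" "k \<in> T" "i \<in> I" for w' k i
    using that(1,3) w[OF that(3,2)] unfolding atom_def same_atom_def by simp_all
  have atom_K: "atom k \<subseteq> K i" if "k \<in> T" "i \<in> I" for k i
    using in_atom(1) that by blast
  have point_atom: "point X K \<mu> (atom k) i = X i (w k)" if "k \<in> T" "i \<in> I" for k i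
  proof -
    have "w k \<in> atom k"
      by (auto simp: atom_def same_atom_def)
    then have "X i ` atom k = {X i (w k)}"
      using in_atom(2) that by blast
    then show ?thesis
      using atom_K[OF that] by (simp add: point_def)
  qed
  \<comment> \<open>Change of variables for the pushforward. Taking \<open>f\<close> as a coordinate
    of \<open>point\<close>, as 1 and as the indicator of \<open>C \<subseteq> K i\<close> yields
    the prevision equations, the total mass and the mass of \<open>K i\<close>.\<close>
  have mix: "(\<Sum>C\<in>?N. \<Lambda> C * f C) = (\<Sum>k\<in>T. p k * f (atom k))" for f
  proof -
    have "(\<Sum>C\<in>?N. \<Lambda> C * f C) = (\<Sum>C\<in>?N. \<Sum>k\<in>T. if C = atom k then p k * f (atom k) else 0)"
      by (auto simp: \<Lambda>_def sum_distrib_right intro!: sum.cong)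
    also have "\<dots> = (\<Sum>k\<in>T. \<Sum>C\<in>?N. if C = atom k then p k * f (atom k) else 0)"
      by (rule sum.swap)
    also have "\<dots> = (\<Sum>k\<in>T. p k * f (atom k))"
      using finN atom_N by (intro sum.cong) auto
    finally show ?thesis .
  qed
  have \<Lambda>_nonneg: "0 \<le> \<Lambda> C" for C
    using p_nonneg by (auto simp: \<Lambda>_def intro!: sum_nonneg)
  have "(\<Sum>C\<in>?N. \<Lambda> C * point X K \<mu> C i) = \<mu> i" if "i \<in> I" for i
    using that by (simp add: mix point_atom prev)
  then have sol: "\<Lambda> \<in> solutions X K \<mu> I"
    using \<Lambda>_nonneg mix[of "\<lambda>_. 1"] p_sum by (auto simp: solutions_def)
  have "i \<notin> zero_indices X K \<mu> I" if "i \<in> I" for i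
  proof -
    let ?g = "\<lambda>\<Lambda>. \<Sum>C | C \<in> ?N \<and> C \<subseteq> K i. \<Lambda> C"
    have "?g \<Lambda> = (\<Sum>C\<in>?N. \<Lambda> C * (if C \<subseteq> K i then 1 else 0))"
      by (rule sum.mono_neutral_cong_left[OF finN]) auto
    also have "\<dots> = 1"
      using that p_sum atom_K by (simp add: mix)
    finally have "?g \<Lambda> = 1" .
    \<comment> \<open>A real supremum dominates its members only if they are bounded above; here
      total mass 1 is a bound.\<close>
    moreover have "?g \<Lambda> \<le> (SUP \<Lambda>\<in>solutions X K \<mu> I. ?g \<Lambda>)"
    proof (rule cSUP_upper[OF sol], rule bdd_aboveI2)
      fix \<Lambda>' assume "\<Lambda>' \<in> solutions X K \<mu> I"
      then have "sum \<Lambda>' ?N = 1" "\<And>C. C \<in> ?N \<Longrightarrow> 0 \<le> \<Lambda>' C"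
        by (auto simp: solutions_def)
      moreover from this have "?g \<Lambda>' \<le> sum \<Lambda>' ?N"
        using finN by (intro sum_mono2) auto
      ultimately show "?g \<Lambda>' \<le> 1"
        by simp
    qed
    ultimately show ?thesis
      by (auto simp: zero_indices_def)
  qed
  then have "zero_indices X K \<mu> I = {}"
    by (auto simp: zero_indices_def)
  then show ?thesis
    using fam sol by (subst coherent.simps) auto
qed

section \<open>The comonotone coupling\<close>

text \<open>The law of the random set \<open>{i \<in> A. U \<le> a i}\<close> with \<open>U\<close> uniform on \<open>[0, 1]\<close>.\<close>

lemma comonotone_coupling:
  fixes a :: "'i \<Rightarrow> real"
  assumes "finite A" and "\<forall>i\<in>A. a i \<in> {0..1}"
  shows "\<exists>p. (\<forall>J\<in>Pow A. 0 \<le> p J) \<and> sum p (Pow A) = 1 \<and>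
    p A = (if A = {} then 1 else Min (a ` A)) \<and>
    (\<forall>S\<subseteq>A. S \<noteq> {} \<longrightarrow> (\<Sum>J\<in>Pow A. p J * of_bool (S \<subseteq> J)) = Min (a ` S))"
  using assms
\<comment> \<open>Ranking by \<open>- a\<close> inserts the indices in decreasing order of
  \<open>a\<close>, so the new \<open>b\<close> has the least value. The clause on
  \<open>p A\<close> serves the induction: it ensures that \<open>A\<close> carries at least the
  mass \<open>a b\<close> to be moved. For empty \<open>A\<close> the minimum is read as 1, the top
  of the unit interval.\<close>
proof (induction A rule: finite_ranking_induct[where f = "\<lambda>i. - a i"])
  case empty
  show ?case
    by (rule exI[of _ "\<lambda>_. 1"]) auto
next
  case (insert b A)
  then have least: "a b \<le> a i" if "i \<in> A" for i
    using that by auto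
  show ?case
  \<comment> \<open>The ranking induction does not guarantee that the inserted element is
    new.\<close>
  proof (cases "b \<in> A")
    case True
    then show ?thesis
      using insert.IH insert.prems unfolding insert_absorb[OF True] by blast
  next
    case False
    from insert obtain p where p_nonneg: "\<And>J. J \<subseteq> A \<Longrightarrow> 0 \<le> p J"
      and p_sum: "sum p (Pow A) = 1"
      and p_top: "p A = (if A = {} then 1 else Min (a ` A))"
      and p_min: "\<And>S. S \<subseteq> A \<Longrightarrow> S \<noteq> {} \<Longrightarrow>
        (\<Sum>J\<in>Pow A. p J * of_bool (S \<subseteq> J)) = Min (a ` S)"
      by auto
    have ab: "0 \<le> a b" "a b \<le> 1"
      using insert.prems by auto
    have le_top: "a b \<le> p A"
      using ab least \<open>finite A\<close> by (auto simp: p_top)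
    \<comment> \<open>Part of the mass on the full set \<open>A\<close> moves to \<open>insert b A\<close>.\<close>
    define q where "q J = (if J = insert b A then a b else if b \<in> J then 0
      else if J = A then p A - a b else p J)" for J
    \<comment> \<open>Among the sets containing \<open>b\<close> only \<open>insert b A\<close> is
      charged, and among the others only the mass at \<open>A\<close> changes, so an expectation
      shifts by a single correction term.\<close>
    have q_sum: "(\<Sum>J\<in>Pow (insert b A). q J * f J) =
        (\<Sum>J\<in>Pow A. p J * f J) + a b * (f (insert b A) - f A)" for f
    proof -
      have "(\<Sum>J\<in>Pow (insert b A). q J * f J) =
          (\<Sum>J\<in>Pow A. q J * f J) + (\<Sum>J\<in>insert b ` Pow A. q J * f J)"
        unfolding Pow_insert using \<open>finite A\<close> False by (intro sum.union_disjoint) auto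
      also have "(\<Sum>J\<in>insert b ` Pow A. q J * f J) = (\<Sum>J\<in>{insert b A}. q J * f J)"
        using \<open>finite A\<close> by (intro sum.mono_neutral_right) (auto simp: q_def)
      also have "\<dots> = a b * f (insert b A)"
        by (simp add: q_def)
      also have "(\<Sum>J\<in>Pow A. q J * f J) =
          (\<Sum>J\<in>Pow A. p J * f J - (if J = A then a b * f A else 0))"
        using False by (intro sum.cong) (auto simp: q_def algebra_simps)
      also have "\<dots> = (\<Sum>J\<in>Pow A. p J * f J) - a b * f A"
        using \<open>finite A\<close> by (simp add: sum_subtractf)
      finally show ?thesis
        by (simp add: algebra_simps)
    qed
    have Min_b: "Min (a ` S) = a b" if "S \<subseteq> insert b A" "b \<in> S" for S
      using that least \<open>finite A\<close> finite_subset[OF that(1)] by (intro Min_eqI) auto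
    have "(\<Sum>J\<in>Pow (insert b A). q J * of_bool (S \<subseteq> J)) = Min (a ` S)"
      if S: "S \<subseteq> insert b A" "S \<noteq> {}" for S
    \<comment> \<open>If \<open>b \<in> S\<close>, no subset of \<open>A\<close> contains
      \<open>S\<close> and only the correction \<open>a b\<close> survives. Otherwise both
      \<open>A\<close> and \<open>insert b A\<close> contain \<open>S\<close>, and the correction
      cancels.\<close>
    proof (cases "b \<in> S")
      case True
      then have "\<not> S \<subseteq> J" if "J \<subseteq> A" for J
        using False that by blast
      then have "(\<Sum>J\<in>Pow A. p J * of_bool (S \<subseteq> J)) = 0" "\<not> S \<subseteq> A"
        by (auto intro!: sum.neutral)
      with S show ?thesis
        by (simp add: q_sum Min_b[OF S(1) True])
    next
      case False
      then have "S \<subseteq> A"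
        using S by auto
      then show ?thesis
        using S p_min by (simp add: q_sum)
    qed
    moreover have "0 \<le> q J" if "J \<subseteq> insert b A" for J
      using that ab le_top p_nonneg[of J] by (auto simp: q_def)
    moreover have "sum q (Pow (insert b A)) = 1"
      using q_sum[of "\<lambda>_. 1"] p_sum by simp
    moreover have "q (insert b A) = Min (a ` insert b A)"
      using Min_b[of "insert b A"] by (simp add: q_def)
    ultimately show ?thesis
      by (intro exI[of _ q]) auto
  qed
qed

section \<open>Conjunctions under logical independence and the minimum rule\<close>

text \<open>\<open>Inl\<close> tags the events \<open>E i\<close> and \<open>Inr\<close> the events
  \<open>H i\<close>, so \<open>J <+> A\<close> is the choice of true events in which every
  \<open>H i\<close> holds and \<open>E i\<close> holds exactly for
  \<open>i \<in> J\<close>.\<close>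

lemma independent_outcome:
  assumes "logically_independent (A <+> A) (case_sum E H)" and "J \<subseteq> A"
  shows "\<exists>w. \<forall>i\<in>A. w \<in> H i \<and> (w \<in> E i \<longleftrightarrow> i \<in> J)"
proof -
  have "J <+> A \<subseteq> A <+> A"
    using assms(2) by auto
  with assms(1) have "(\<Inter>i\<in>J <+> A. case_sum E H i) \<inter>
      (\<Inter>i\<in>(A <+> A) - (J <+> A). - case_sum E H i) \<noteq> {}"
    unfolding logically_independent_def by blast
  then obtain w where w: "\<And>i. i \<in> J <+> A \<Longrightarrow> w \<in> case_sum E H i"
      "\<And>i. i \<in> (A <+> A) - (J <+> A) \<Longrightarrow> w \<notin> case_sum E H i"
    by blast
  have "w \<in> H i \<and> (w \<in> E i \<longleftrightarrow> i \<in> J)" if "i \<in> A" for i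
    using that w(1)[of "Inr i"] w(1)[of "Inl i"] w(2)[of "Inl i"] by auto
  then show ?thesis
    by blast
qed

text \<open>A false conditional event contributes 0, the least possible value, and a true one
  contributes 1, which never lowers a minimum of values in the unit interval. With none false and
  some void, the minimum is thus taken over the void ones, where the rule for \<open>x\<close> turns
  it into \<open>x S'\<close>.\<close>

lemma conjunction_eq_Min:
  assumes "finite S" "S \<noteq> {}" and range: "\<forall>i\<in>S. x {i} \<in> {0..1}"
    and x_Min: "\<forall>S'\<subseteq>S. S' \<noteq> {} \<longrightarrow> x S' = (MIN i\<in>S'. x {i})"
  shows "conjunction E H x S w = (MIN i\<in>S. conjunction E H x {i} w)"
proof -
  let ?c = "\<lambda>i. conjunction E H x {i} w"
  have sing: "?c i = (if w \<in> H i then of_bool (w \<in> E i) else x {i})" for i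
    by (auto simp: conjunction_def intro!: arg_cong[of _ _ x])
  have nonneg: "0 \<le> ?c i" and le_1: "?c i \<le> 1" if "i \<in> S" for i
    using that range by (auto simp: sing)
  define S' where "S' = {i \<in> S. w \<notin> H i}"
  consider "\<forall>i\<in>S. w \<in> E i \<inter> H i" | i where "i \<in> S" "w \<in> - E i \<inter> H i"
    | "S' \<noteq> {}" "\<forall>i\<in>S. w \<notin> - E i \<inter> H i"
    by (auto simp: S'_def)
  then show ?thesis
  proof cases
    case 1
    then have "?c ` S = {1}"
      using \<open>S \<noteq> {}\<close> by (auto simp: sing)
    with 1 show ?thesis
      by (simp add: conjunction_def)
  next
    case 2
    then have "?c i = 0"
      by (simp add: sing)
    then have "Min (?c ` S) = 0"
      using assms(1) nonneg 2(1) by (intro Min_eqI) force+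
    moreover have "conjunction E H x S w = 0"
      using 2 by (auto simp: conjunction_def)
    ultimately show ?thesis
      by simp
  next
    case 3
    have fin': "finite S'"
      using assms(1) by (simp add: S'_def)
    have c_S': "?c ` S' = (\<lambda>i. x {i}) ` S'"
      by (auto simp: S'_def sing)
    have in_S': "Min (?c ` S') \<in> ?c ` S'"
      using fin' 3 by (intro Min_in) auto
    have "Min (?c ` S') \<le> ?c i" if "i \<in> S" for i
    proof (cases "i \<in> S'")
      case True
      then show ?thesis
        using fin' by simp
    next
      case False
      with that 3 have "?c i = 1"
        by (auto simp: S'_def sing)
      then show ?thesis
        using in_S' le_1 by (auto simp: S'_def)
    qed
    then have "Min (?c ` S) = Min (?c ` S')"
      using assms(1) in_S' by (intro Min_eqI) (auto simp: S'_def)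
    also have "\<dots> = x S'"
      unfolding c_S' using 3 by (intro x_Min[rule_format, symmetric]) (auto simp: S'_def)
    also have "\<dots> = conjunction E H x S w"
      using 3 by (auto simp: conjunction_def S'_def)
    finally show ?thesis
      by simp
  qed
qed

lemma cond_rq_family_conjunction:
  assumes "finite A" and "\<forall>i\<in>A. H i \<noteq> {}"
  shows "cond_rq_family (conjunction E H x) (conditioning H) {S. S \<subseteq> A \<and> S \<noteq> {}}"
proof -
  have "finite (range (conjunction E H x S))" if "S \<subseteq> A" for S
  proof (rule finite_subset)
    show "range (conjunction E H x S) \<subseteq> {0, 1} \<union> x ` Pow S"
      by (auto simp: conjunction_def)
    show "finite ({0, 1} \<union> x ` Pow S)"
      using finite_subset[OF that assms(1)] by simp
  qed
  then have "finite (conjunction E H x S ` conditioning H S)" if "S \<subseteq> A" for S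
    using that by (blast intro: finite_subset[OF image_mono[OF subset_UNIV]])
  moreover have "conditioning H S \<noteq> {}" if "S \<subseteq> A" "S \<noteq> {}" for S
    using that assms(2) by (auto simp: conditioning_def)
  ultimately show ?thesis
    using assms(1) by (auto simp: cond_rq_family_def)
qed

text \<open>The outcomes \<open>w J\<close>, weighted by the coupling, form the mixture: the
  prevision of the conjunction over \<open>S\<close> becomes the probability that the random set
  contains \<open>S\<close>, which is the prescribed minimum.\<close>

lemma coherent_conjunction:
  assumes indep: "logically_independent (A <+> A) (case_sum E H)"
    and "finite A" "A \<noteq> {}" and "\<forall>i\<in>A. H i \<noteq> {}" and range: "\<forall>i\<in>A. x {i} \<in> {0..1}"
    and x_Min: "\<forall>S\<subseteq>A. S \<noteq> {} \<longrightarrow> x S = (MIN i\<in>S. x {i})"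
  shows "coherent (conjunction E H x) (conditioning H) x {S. S \<subseteq> A \<and> S \<noteq> {}}"
proof -
  have "\<forall>J\<in>Pow A. \<exists>w. \<forall>i\<in>A. w \<in> H i \<and> (w \<in> E i \<longleftrightarrow> i \<in> J)"
    using independent_outcome[OF indep] by blast
  from bchoice[OF this] obtain w
    where "\<forall>J\<in>Pow A. \<forall>i\<in>A. w J \<in> H i \<and> (w J \<in> E i \<longleftrightarrow> i \<in> J)" ..
  then have w: "w J \<in> H i" "w J \<in> E i \<longleftrightarrow> i \<in> J" if "J \<subseteq> A" "i \<in> A" for i J
    using that by blast+
  obtain p where p: "\<forall>J\<in>Pow A. 0 \<le> p J" "sum p (Pow A) = 1"
      "\<forall>S\<subseteq>A. S \<noteq> {} \<longrightarrow> (\<Sum>J\<in>Pow A. p J * of_bool (S \<subseteq> J)) = (MIN i\<in>S. x {i})"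
    using comonotone_coupling[OF \<open>finite A\<close> range] by blast
  \<comment> \<open>Every \<open>H i\<close> holds at \<open>w J\<close>, so the branch with values
    of \<open>x\<close> is never reached and the conjunction is an indicator.\<close>
  have conj_w: "conjunction E H x S (w J) = of_bool (S \<subseteq> J)" if "S \<subseteq> A" "J \<subseteq> A" for S J
  proof (cases "S \<subseteq> J")
    case True
    then show ?thesis
      using w[OF that(2)] that(1) by (auto simp: conjunction_def)
  next
    case False
    then obtain i where "i \<in> S" "i \<notin> J"
      by auto
    then have "i \<in> S" "w J \<in> - E i \<inter> H i"
      using w[OF that(2), of i] that(1) by auto
    then show ?thesis
      using False by (auto simp: conjunction_def)
  qed
  show ?thesis
  proof (rule coherent_if_mixture[where T = "Pow A" and p = p and w = w])
    show "cond_rq_family (conjunction E H x) (conditioning H) {S. S \<subseteq> A \<and> S \<noteq> {}}"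
      by (rule cond_rq_family_conjunction) fact+
    show "{S. S \<subseteq> A \<and> S \<noteq> {}} \<noteq> {}"
      using \<open>A \<noteq> {}\<close> by auto
    show "finite (Pow A)"
      using \<open>finite A\<close> by simp
    show "0 \<le> p J" if "J \<in> Pow A" for J
      using p that by blast
    show "sum p (Pow A) = 1"
      by fact
    show "w J \<in> conditioning H S" if "S \<in> {S. S \<subseteq> A \<and> S \<noteq> {}}" "J \<in> Pow A" for S J
      using that w unfolding conditioning_def by blast
    show "(\<Sum>J\<in>Pow A. p J * conjunction E H x S (w J)) = x S"
      if S: "S \<in> {S. S \<subseteq> A \<and> S \<noteq> {}}" for S
    proof -
      have "(\<Sum>J\<in>Pow A. p J * conjunction E H x S (w J)) = (\<Sum>J\<in>Pow A. p J * of_bool (S \<subseteq> J))"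
        using S by (intro sum.cong) (auto simp: conj_w)
      then show ?thesis
        using S p(3) x_Min[rule_format, of S] by simp
    qed
  qed
qed

section \<open>Three conditional events\<close>

theorem theorem9:
  fixes E H :: "nat \<Rightarrow> 'w set" and x :: "nat set \<Rightarrow> real"
  assumes "logically_independent ({1, 2, 3} <+> {1, 2, 3}) (case_sum E H)"
    and "\<forall>i\<in>{1, 2, 3}. H i \<noteq> {}"
    and "\<forall>i\<in>{1, 2, 3}. x {i} \<in> {0..1}"
    and "\<forall>i\<in>{1, 2, 3}. \<forall>j\<in>{1, 2, 3}. i \<noteq> j \<longrightarrow> x {i, j} = min (x {i}) (x {j})"
    and "x {1, 2, 3} = Min {x {1}, x {2}, x {3}}"
  shows "coherent (conjunction E H x) (conditioning H) x {S. S \<subseteq> {1, 2, 3} \<and> S \<noteq> {}} \<and>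
    (\<forall>i\<in>{1, 2, 3}. \<forall>j\<in>{1, 2, 3}. i \<noteq> j \<longrightarrow>
       conjunction E H x {i, j} =
         (\<lambda>w. min (conjunction E H x {i} w) (conjunction E H x {j} w))) \<and>
    conjunction E H x {1, 2, 3} =
      (\<lambda>w. Min {conjunction E H x {1} w, conjunction E H x {2} w, conjunction E H x {3} w})"
proof -
  \<comment> \<open>The separate rules for pairs and for the triple, together with the trivial case
    of singletons, take the uniform form used by the general lemmas.\<close>
  have x_Min: "\<forall>S\<subseteq>{1, 2, 3}. S \<noteq> {} \<longrightarrow> x S = (MIN i\<in>S. x {i})"
  proof (intro allI impI)
    fix S :: "nat set"
    assume S: "S \<subseteq> {1, 2, 3}" "S \<noteq> {}"
    from S(1) have "S \<in> Pow {1, 2, 3}"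
      by (rule PowI)
    \<comment> \<open>Listing the subsets lets each nonempty one be matched with the hypothesis for
      its size.\<close>
    also have "Pow {1, 2, 3 :: nat} = {{}, {3}, {2}, {2, 3}, {1}, {1, 3}, {1, 2}, {1, 2, 3}}"
      by (simp only: Pow_insert Pow_empty image_insert image_empty Un_insert_left Un_empty_left)
    finally show "x S = (MIN i\<in>S. x {i})"
      unfolding insert_iff empty_iff using assms(4,5) S(2)
      by (elim disjE) (simp_all add: min.assoc)
  qed
  have conj_Min: "conjunction E H x S w = (MIN i\<in>S. conjunction E H x {i} w)"
    if "S \<subseteq> {1, 2, 3}" "S \<noteq> {}" for S w
  proof (rule conjunction_eq_Min)
    show "finite S"
      using that(1) by (rule finite_subset) simp
    show "\<forall>i\<in>S. x {i} \<in> {0..1}"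
      using assms(3) that(1) by blast
    show "\<forall>S'\<subseteq>S. S' \<noteq> {} \<longrightarrow> x S' = (MIN i\<in>S'. x {i})"
      using x_Min that(1) by blast
  qed (rule that(2))
  show ?thesis
  proof (intro conjI ballI impI)
    show "coherent (conjunction E H x) (conditioning H) x {S. S \<subseteq> {1, 2, 3} \<and> S \<noteq> {}}"
      by (rule coherent_conjunction[OF assms(1) _ _ assms(2,3) x_Min]) simp_all
  next
    fix i j :: nat
    assume ij: "i \<in> {1, 2, 3}" "j \<in> {1, 2, 3}"
    show "conjunction E H x {i, j} =
        (\<lambda>w. min (conjunction E H x {i} w) (conjunction E H x {j} w))"
    proof
      fix w
      have "conjunction E H x {i, j} w = (MIN k\<in>{i, j}. conjunction E H x {k} w)"
        using ij by (intro conj_Min) auto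
      then show "conjunction E H x {i, j} w =
          min (conjunction E H x {i} w) (conjunction E H x {j} w)"
        by simp
    qed
  next
    show "conjunction E H x {1, 2, 3} =
        (\<lambda>w. Min {conjunction E H x {1} w, conjunction E H x {2} w, conjunction E H x {3} w})"
    proof
      fix w
      have "conjunction E H x {1, 2, 3} w = (MIN k\<in>{1, 2, 3}. conjunction E H x {k} w)"
        by (intro conj_Min) auto
      then show "conjunction E H x {1, 2, 3} w =
          Min {conjunction E H x {1} w, conjunction E H x {2} w, conjunction E H x {3} w}"
        by (simp only: image_insert image_empty)
    qed
  qed
qed

end
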